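(* Let $\psi_q$ denote the $q$-digamma function. The functions \begin{align*} \phi_q(x)&=\psi_q(x)+\ln\left[\exp\left(\frac{(\ln q)q^{x}}{q^{x}-1}\right)-1\right],\quad q>1,\\ \varphi_q(x)&=\psi_{q}(x)+\ln\left[\exp\left(\frac{\ln q}{q^{x}-1}\right)-1\right],\quad q>1,\\ \Phi_q(x)&=\psi_{q}(x)-(\ln q)x+\ln\left[\exp\left(\frac{(\ln q)q^{x}}{q^{x}-1}\right)-1\right],\quad 0<q<1,\\ \Theta_q(x)&=\psi_{q}(x)-(\ln q)x+\ln\left[\exp\left(\frac{\ln q}{q^{x}-1}\right)-1\right],\quad 0<q<1 \end{align*} are increasing in $x$ on $(0,\infty)$ (for each fixed $q$ in the indicated range). Consequently, the following double inequalities hold for all $x\in(0,\infty)$: (i) for $0<q<1$, $$\psi_{q}(1)+(\ln q)x-\ln\left[\exp\left(\frac{(\ln q)q^{x}}{q^{x}-1}\right)-1\right]<\psi_{q}(x)<\ln\frac{\ln q}{q-1}+(\ln q)x-\ln\left[\exp\left(\frac{(\ln q)q^{x}}{q^{x}-1}\right)-1\right];$$ (ii) for $q>1$, $$\psi_{q}(1)-\ln q-\ln\left[\exp\left(\frac{\ln q}{q^{x}-1}\right)-1\right]<\psi_{q}(x)<\ln\frac{\ln q}{q-1}-\frac{\ln q}{2}-\ln\left[\exp\left(\frac{\ln q}{q^{x}-1}\right)-1\right].$$ Moreover, the constants $\psi_q(1)$ and $\ln\frac{\ln q}{q-1}$ in (i), and the constants $\psi_q(1)-\ln q$ and $\ln\frac{\ln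 q}{q-1}-\frac{\ln q}{2}$ in (ii), are the best possible.
   Context: For $x>0$ the $q$-gamma function is defined by $$\Gamma_q(x)=(1-q)^{1-x}\prod_{i=0}^\infty\frac{1-q^{i+1}}{1-q^{i+x}}\quad\text{for }0<q<1,$$ $$\Gamma_q(x)=(q-1)^{1-x}q^{\binom{x}{2}}\prod_{i=0}^\infty\frac{1-q^{-(i+1)}}{1-q^{-(i+x)}}\quad\text{for }q>1,$$ where $\binom{x}{2}=\frac{x(x-1)}{2}$. For $q>0$, $q\neq1$ and $x>0$, the $q$-digamma function is $\psi_q(x)=\Gamma_q'(x)/\Gamma_q(x)$ (derivative in $x$). Explicitly, for $x>0$: $\psi_q(x)=-\ln(1-q)+(\ln q)\sum_{k=1}^\infty\frac{q^{kx}}{1-q^{k}}$ when $0<q<1$, and $\psi_q(x)=-\ln(q-1)+(\ln q)\Bigl[x-\frac12-\sum_{i=1}^\infty\frac{q^{-ix}}{1-q^{-i}}\Bigr]$ when $q>1$. "Best possible" means that, for each fixed $q$ in the given range, the constant in the lower bound cannot be replaced by a larger number (independent of $x$), and the constant in the upper bound cannot be replaced by a smaller number (independent of $x$), with the inequality remaining valid for all $x\in(0,\infty)$. *)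

theory Defs
  imports "HOL-Analysis.Analysis"
begin

text \<open>
  The \<open>q\<close>-gamma function; meaningful for \<open>q > 0\<close>, \<open>q \<noteq> 1\<close> and \<open>x > 0\<close>. For these arguments all
  factors are positive and both products converge to a nonzero limit, as \<^const>\<open>prodinf\<close> requires.
\<close>

definition q_Gamma :: "real \<Rightarrow> real \<Rightarrow> real" where
  "q_Gamma q x =
    (if q < 1 then
       (1 - q) powr (1 - x) *
         (\<Prod>i. (1 - q powr (real i + 1)) / (1 - q powr (real i + x)))
     else
       (q - 1) powr (1 - x) * q powr (x * (x - 1) / 2) *
         (\<Prod>i. (1 - q powr - (real i + 1)) / (1 - q powr - (real i + x))))"

definition q_digamma :: "real \<Rightarrow> real \<Rightarrow> real" where
  "q_digamma q x = deriv (q_Gamma q) x / q_Gamma q x"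

definition q_phi :: "real \<Rightarrow> real \<Rightarrow> real" where
  "q_phi q x = q_digamma q x + ln (exp (ln q * q powr x / (q powr x - 1)) - 1)"

definition q_varphi :: "real \<Rightarrow> real \<Rightarrow> real" where
  "q_varphi q x = q_digamma q x + ln (exp (ln q / (q powr x - 1)) - 1)"

definition q_Phi :: "real \<Rightarrow> real \<Rightarrow> real" where
  "q_Phi q x = q_digamma q x - ln q * x + ln (exp (ln q * q powr x / (q powr x - 1)) - 1)"

definition q_Theta :: "real \<Rightarrow> real \<Rightarrow> real" where
  "q_Theta q x = q_digamma q x - ln q * x + ln (exp (ln q / (q powr x - 1)) - 1)"

end

theory Submission
  imports Defs
begin

text \<open>
  Put \<open>0 < p < 1\<close> and \<open>t = p\<^sup>x\<close>. The \<open>p\<close>-digamma function is, up to a constant, \<open>ln p\<close> times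
  the Lambert series \<open>P(t) = \<Sum>\<^bsub>n \<ge> 1\<^esub> t\<^sup>n / (1 - p\<^sup>n)\<close>, and
  \<open>P(t) - P(pt) = t / (1 - t)\<close>. With \<open>G(t) = exp (ln p \<cdot> P(t))\<close> this recurrence says that the exponential
  occurring in \<^const>\<open>q_Phi\<close> is \<open>G(pt) / G(t)\<close>, and so
  \<open>exp (q_Phi p x) = (G(pt) - G(t)) / (t (1 - p))\<close>, which is minus the slope of the chord of \<open>G\<close> over
  \<open>[pt, t]\<close>. Since \<open>t\<close> decreases as \<open>x\<close> grows, \<^const>\<open>q_Phi\<close> increases if these slopes increase with
  \<open>t\<close>, and they do if \<open>G\<close> is strictly convex (\<open>dilated_difference_quotient_decreasing\<close>).

  Convexity of \<open>G\<close> is the inequality \<open>P'' < (- ln p) P'\<^sup>2\<close>, and this holds coefficient by coefficient.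
  With \<open>c\<^sub>n = 1 / (1 - p\<^sup>n)\<close>, the \<open>n - 1\<close> terms of the convolution giving a coefficient of the right-hand
  side each exceed the share \<open>n c\<^sub>n\<close> of the coefficient \<open>n (n - 1) c\<^sub>n\<close> on the left
  (\<open>lambert_coeff_convolution\<close>); behind this is the elementary bound \<open>coth y > 1 / y\<close>.

  The other three functions reduce to \<^const>\<open>q_Phi\<close>: \<^const>\<open>q_Theta\<close> exceeds it by an increasing function,
  and passing from a base \<open>q > 1\<close> to \<open>1 / q\<close> changes the \<open>q\<close>-digamma function only by the linear function
  \<open>(x - 3 / 2) ln q\<close>, which turns \<^const>\<open>q_varphi\<close> and \<^const>\<open>q_phi\<close> into \<^const>\<open>q_Phi\<close> and
  \<^const>\<open>q_Theta\<close> up to a constant. Finally, for a strictly increasing function the limits at \<open>0\<close> and at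
  infinity are strict bounds, and the best ones; these limits are the constants in the double
  inequalities.
\<close>

section \<open>The Lambert series and the q-gamma function\<close>

definition lambert :: "real \<Rightarrow> real \<Rightarrow> real" where
  "lambert p t = (\<Sum>n. 1 / (1 - p ^ n) * t ^ n)"

text \<open>
  This is \<open>- ln \<Prod>\<^bsub>i \<ge> 0\<^esub> (1 - p\<^sup>i t)\<close>, the negative logarithm of the infinite \<open>q\<close>-Pochhammer symbol of
  base \<open>p\<close>, written as a power series so that it can be differentiated term by term. Here and in
  \<open>lambert\<close>, the term with \<open>n = 0\<close> vanishes because of \<open>1 / 0 = 0\<close>.
\<close>

definition log_pochhammer_inv :: "real \<Rightarrow> real \<Rightarrow> real" where
  "log_pochhammer_inv p t = (\<Sum>n. 1 / (real n * (1 - p ^ n)) * t ^ n)"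

lemma summable_bounded_coeffs:
  fixes c :: "nat \<Rightarrow> real"
  assumes "\<And>n. \<bar>c n\<bar> \<le> C" "norm t < 1"
  shows "summable (\<lambda>n. c n * t ^ n)"
proof (rule summable_comparison_test')
  show "summable (\<lambda>n. C * \<bar>t\<bar> ^ n)"
    using assms by (intro summable_mult summable_geometric) auto
  show "norm (c n * t ^ n) \<le> C * \<bar>t\<bar> ^ n" if "n \<ge> 0" for n
    using assms(1) by (simp add: abs_mult power_abs mult_right_mono)
qed

context
  fixes p :: real
  assumes p: "0 < p" "p < 1"
begin

lemma power_less_one_pos: "n > 0 \<Longrightarrow> p ^ n < 1"
  using p by (simp add: power_less_one_iff)

lemma lambert_coeff_bound: "\<bar>1 / (1 - p ^ n)\<bar> \<le> 1 / (1 - p)"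
proof (cases "n = 0")
  case False
  have "p ^ n \<le> p ^ 1"
    using p False by (intro power_decreasing) auto
  then show ?thesis
    using p by (simp add: frac_le)
qed (use p in simp)

lemma log_coeff_bound: "\<bar>1 / (real n * (1 - p ^ n))\<bar> \<le> 1 / (1 - p)"
proof (cases "n = 0")
  case False
  have "\<bar>1 / (real n * (1 - p ^ n))\<bar> = \<bar>1 / (1 - p ^ n)\<bar> / real n"
    by (simp add: abs_mult)
  also have "\<dots> \<le> \<bar>1 / (1 - p ^ n)\<bar> / 1"
    using False by (intro divide_left_mono) auto
  finally show ?thesis
    using lambert_coeff_bound[of n] by simp
qed (use p in simp)

lemma summable_lambert: "norm t < 1 \<Longrightarrow> summable (\<lambda>n. 1 / (1 - p ^ n) * t ^ n)"
  by (rule summable_bounded_coeffs[of "\<lambda>n. 1 / (1 - p ^ n)", OF lambert_coeff_bound])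

lemma summable_log: "norm t < 1 \<Longrightarrow> summable (\<lambda>n. 1 / (real n * (1 - p ^ n)) * t ^ n)"
  by (rule summable_bounded_coeffs[of "\<lambda>n. 1 / (real n * (1 - p ^ n))", OF log_coeff_bound])

lemma abs_scaled_less_one: "\<bar>t\<bar> < 1 \<Longrightarrow> \<bar>p * t\<bar> < 1"
  using p mult_left_le_one_le[of "\<bar>t\<bar>" p] by (simp add: abs_mult)

text \<open>
  The power series of \<open>- ln (1 - s)\<close> appears because the factor \<open>1 - p\<^sup>n\<close> in the denominators cancels.
  Iterating this functional equation yields the infinite product, without any interchange of
  summations.
\<close>

lemma log_pochhammer_inv_diff:
  assumes "\<bar>s\<bar> < 1"
  shows "log_pochhammer_inv p s - log_pochhammer_inv p (p * s) = - ln (1 - s)"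
proof -
  have ps: "\<bar>p * s\<bar> < 1"
    by (rule abs_scaled_less_one[OF assms])
  have "log_pochhammer_inv p s - log_pochhammer_inv p (p * s)
      = (\<Sum>n. 1 / (real n * (1 - p ^ n)) * s ^ n - 1 / (real n * (1 - p ^ n)) * (p * s) ^ n)"
    unfolding log_pochhammer_inv_def
    using summable_log[of s] summable_log[of "p * s"] assms ps by (intro suminf_diff) auto
  also have "\<dots> = (\<Sum>n. s ^ n / real n)"
  proof (rule suminf_cong)
    fix n :: nat
    show "1 / (real n * (1 - p ^ n)) * s ^ n - 1 / (real n * (1 - p ^ n)) * (p * s) ^ n = s ^ n / real n"
    proof (cases "n = 0")
      case False
      then have "1 - p ^ n \<noteq> 0"
        using power_less_one_pos[of n] by auto
      moreover have "1 / (real n * (1 - p ^ n)) * s ^ n - 1 / (real n * (1 - p ^ n)) * (p * s) ^ n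
          = (1 - p ^ n) * s ^ n / (real n * (1 - p ^ n))"
        by (simp add: power_mult_distrib left_diff_distrib diff_divide_distrib)
      ultimately show ?thesis
        by simp
    qed simp
  qed
  also have "\<dots> = - ln (1 - s)"
    using sums_minus[OF ln_series'[of "- s"]] assms by (simp add: sums_iff)
  finally show ?thesis .
qed

text \<open>
  The recurrence of the \<open>p\<close>-digamma function under \<open>x \<mapsto> x + 1\<close>, that is, \<open>t \<mapsto> p t\<close>; again the
  denominators cancel, here leaving a geometric series.
\<close>

lemma lambert_diff:
  assumes "\<bar>t\<bar> < 1"
  shows "lambert p t - lambert p (p * t) = t / (1 - t)"
proof -
  have ps: "\<bar>p * t\<bar> < 1"
    by (rule abs_scaled_less_one[OF assms])
  have "lambert p t - lambert p (p * t)
      = (\<Sum>n. 1 / (1 - p ^ n) * t ^ n - 1 / (1 - p ^ n) * (p * t) ^ n)"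
    unfolding lambert_def
    using summable_lambert[of t] summable_lambert[of "p * t"] assms ps
    by (intro suminf_diff) auto
  also have "\<dots> = (\<Sum>n. if n = 0 then 0 else t ^ n)"
  proof (rule suminf_cong)
    fix n :: nat
    show "1 / (1 - p ^ n) * t ^ n - 1 / (1 - p ^ n) * (p * t) ^ n = (if n = 0 then 0 else t ^ n)"
    proof (cases "n = 0")
      case False
      then have "1 - p ^ n \<noteq> 0"
        using power_less_one_pos[of n] by auto
      moreover have "1 / (1 - p ^ n) * t ^ n - 1 / (1 - p ^ n) * (p * t) ^ n
          = (1 - p ^ n) * t ^ n / (1 - p ^ n)"
        by (simp add: power_mult_distrib left_diff_distrib diff_divide_distrib)
      ultimately show ?thesis
        using False by simp
    qed simp
  qed
  also have "\<dots> = t / (1 - t)"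
  proof (rule sums_unique[symmetric])
    have "(\<lambda>n. t * t ^ n) sums (t * (1 / (1 - t)))"
      using assms by (intro sums_mult geometric_sums) auto
    then show "(\<lambda>n. if n = 0 then 0 else t ^ n) sums (t / (1 - t))"
      by (subst sums_Suc_iff[symmetric, where f = "\<lambda>n. if n = 0 then 0 else t ^ n", simplified]) auto
  qed
  finally show ?thesis .
qed

lemma DERIV_log_pochhammer_inv:
  assumes "0 < t" "t < 1"
  shows "(log_pochhammer_inv p has_real_derivative lambert p t / t) (at t)"
proof -
  let ?a = "\<lambda>n. 1 / (real n * (1 - p ^ n))"
  have t: "norm t < 1"
    using assms by simp
  have "(\<lambda>n. 1 / (1 - p ^ Suc n) * t ^ Suc n) sums lambert p t"
    using summable_sums[OF summable_lambert[OF t]] unfolding lambert_def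
    by (subst sums_Suc_iff) simp
  then have "(\<lambda>n. 1 / (1 - p ^ Suc n) * t ^ Suc n / t) sums (lambert p t / t)"
    by (rule sums_divide)
  moreover have "1 / (1 - p ^ Suc n) * t ^ Suc n / t = diffs ?a n * t ^ n" for n
    using assms by (simp add: diffs_def)
  ultimately have "(\<Sum>n. diffs ?a n * t ^ n) = lambert p t / t"
    by (simp add: sums_iff)
  then show ?thesis
    using termdiffs_strong'[of 1 ?a t, OF summable_log t]
    by (simp add: log_pochhammer_inv_def[abs_def])
qed

lemma isCont_log_pochhammer_inv_0: "isCont (log_pochhammer_inv p) 0"
  using DERIV_isCont[OF termdiffs_strong'[of 1 "\<lambda>n. 1 / (real n * (1 - p ^ n))" 0, OF summable_log]]
  by (simp add: log_pochhammer_inv_def[abs_def])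

text \<open>
  By the functional equation each factor is a quotient of consecutive values of one sequence, so the
  partial products telescope; what remains of the far end tends to \<open>1\<close> by continuity of
  \<open>log_pochhammer_inv p\<close> at \<open>0\<close>.
\<close>

lemma q_Gamma_prodinf:
  assumes x: "x > 0"
  shows "(\<Prod>i. (1 - p powr (real i + 1)) / (1 - p powr (real i + x)))
     = exp (log_pochhammer_inv p (p powr x) - log_pochhammer_inv p p)"
proof -
  let ?Q = "log_pochhammer_inv p"
  let ?t = "p powr x"
  have t: "0 < ?t" "?t < 1"
    using p x by (auto simp: powr01_less_one)
  have factor: "1 - s = exp (?Q (p * s) - ?Q s)" if "\<bar>s\<bar> < 1" for s
    using log_pochhammer_inv_diff[OF that] that
    by (smt (verit) exp_ln)
  define D where "D = (\<lambda>i. ?Q (p ^ i * ?t) - ?Q (p ^ i * p))"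
  have small: "\<bar>p ^ i * s\<bar> < 1" if "0 < s" "s < 1" for i s
    using that p mult_le_one[of "p ^ i" s] power_le_one[of p i]
    by (smt (verit) mult_left_le_one_le mult_pos_pos zero_less_power)
  have step: "(1 - p powr (real i + 1)) / (1 - p powr (real i + x))
      = exp (D i - D (Suc i))" for i
  proof -
    have "p powr (real i + y) = p ^ i * p powr y" for y
      using p by (simp add: powr_add powr_realpow)
    then have "(1 - p powr (real i + 1)) / (1 - p powr (real i + x)) = (1 - p ^ i * p) / (1 - p ^ i * ?t)"
      using p by simp
    also have "\<dots> = exp (?Q (p * (p ^ i * p)) - ?Q (p ^ i * p)) / exp (?Q (p * (p ^ i * ?t)) - ?Q (p ^ i * ?t))"
      using factor small p t by metis
    finally show ?thesis
      by (simp add: D_def exp_diff[symmetric] algebra_simps)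
  qed
  have partial: "(\<Prod>i\<le>n. (1 - p powr (real i + 1)) / (1 - p powr (real i + x)))
      = exp (D 0 - D (Suc n))" for n
    unfolding step exp_sum[OF finite_atMost, symmetric] sum_telescope ..
  have tail: "(\<lambda>n. ?Q (p ^ Suc n * s)) \<longlonglongrightarrow> ?Q 0" for s
  proof (rule isCont_tendsto_compose[OF isCont_log_pochhammer_inv_0])
    have "(\<lambda>n. p ^ Suc n * s) \<longlonglongrightarrow> 0 * s"
      using p by (intro tendsto_mult tendsto_const LIMSEQ_Suc LIMSEQ_power_zero) auto
    then show "(\<lambda>n. p ^ Suc n * s) \<longlonglongrightarrow> 0" by simp
  qed
  have "(\<lambda>n. \<Prod>i\<le>n. (1 - p powr (real i + 1)) / (1 - p powr (real i + x)))
      \<longlonglongrightarrow> exp (D 0 - (?Q 0 - ?Q 0))"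
    unfolding partial D_def by (intro tendsto_intros tail)
  then have "(\<lambda>i. (1 - p powr (real i + 1)) / (1 - p powr (real i + x))) has_prod exp (?Q ?t - ?Q p)"
    by (simp add: has_prod_def raw_has_prod_def D_def)
  then show ?thesis
    by (rule has_prod_unique[symmetric])
qed

end

section \<open>The q-digamma function\<close>

lemma q_digamma_eq_DERIV_log:
  assumes "x > 0" and Gamma: "\<And>y. y > 0 \<Longrightarrow> q_Gamma q y = exp (h y)"
    and h: "(h has_real_derivative d) (at x)"
  shows "q_digamma q x = d"
proof -
  have "((\<lambda>y. exp (h y)) has_real_derivative exp (h x) * d) (at x)"
    by (rule derivative_eq_intros h refl)+
  then have "(q_Gamma q has_real_derivative exp (h x) * d) (at x)"
    by (rule has_field_derivative_transform_within_open[where S = "{0<..}"])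
      (use assms in auto)
  then show ?thesis
    using assms by (simp add: q_digamma_def DERIV_imp_deriv)
qed

lemma DERIV_log_pochhammer_inv_powr:
  assumes "0 < p" "p < 1" "x > 0"
  shows "((\<lambda>y. log_pochhammer_inv p (p powr y)) has_real_derivative ln p * lambert p (p powr x)) (at x)"
proof -
  have "0 < p powr x" "p powr x < 1"
    using assms by (auto simp: powr01_less_one)
  note outer = DERIV_log_pochhammer_inv[OF assms(1,2) this]
  have "((\<lambda>y. p powr y) has_real_derivative p powr x * ln p) (at x)"
    using assms by (auto intro!: derivative_eq_intros)
  from DERIV_chain2[OF outer this] show ?thesis
    using assms by (simp add: field_simps)
qed

lemma q_digamma_lambert:
  assumes "0 < p" "p < 1" "x > 0"
  shows "q_digamma p x = - ln (1 - p) + ln p * lambert p (p powr x)"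
proof (rule q_digamma_eq_DERIV_log[OF \<open>x > 0\<close>])
  let ?h = "\<lambda>y. (1 - y) * ln (1 - p) + (log_pochhammer_inv p (p powr y) - log_pochhammer_inv p p)"
  show "q_Gamma p y = exp (?h y)" if "y > 0" for y
    using assms that q_Gamma_prodinf[of p y]
    by (simp add: q_Gamma_def exp_add powr_def mult.commute)
  show "(?h has_real_derivative - ln (1 - p) + ln p * lambert p (p powr x)) (at x)"
    by (rule derivative_eq_intros DERIV_log_pochhammer_inv_powr assms refl)+ simp
qed

text \<open>
  The two products agree, because \<open>q powr - y = (1 / q) powr y\<close>. Hence only the elementary prefactors
  contribute: the logarithmic derivative of \<open>q powr (x (x - 1) / 2)\<close> is \<open>(x - 1 / 2) ln q\<close>, and replacing
  \<open>1 - 1 / q\<close> by \<open>q - 1\<close> costs a further \<open>ln q\<close>.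
\<close>

lemma q_digamma_inverse_base:
  assumes q: "q > 1" and x: "x > 0"
  shows "q_digamma q x = q_digamma (1 / q) x + (x - 3 / 2) * ln q"
proof -
  define p where "p = 1 / q"
  have p: "0 < p" "p < 1"
    using q by (auto simp: p_def)
  have powr: "q powr - y = p powr y" for y
    using q by (simp add: p_def powr_def ln_div)
  have ln1p: "ln (1 - p) = ln (q - 1) - ln q"
  proof -
    have "1 - p = (q - 1) / q"
      using q by (simp add: p_def field_simps)
    then show ?thesis
      using q by (simp add: ln_div)
  qed
  let ?h = "\<lambda>y. (1 - y) * ln (q - 1) + y * (y - 1) / 2 * ln q
      + (log_pochhammer_inv p (p powr y) - log_pochhammer_inv p p)"
  have "q_digamma q x = - ln (q - 1) + (x - 1 / 2) * ln q + ln p * lambert p (p powr x)"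
  proof (rule q_digamma_eq_DERIV_log[OF \<open>x > 0\<close>])
    show "q_Gamma q y = exp (?h y)" if "y > 0" for y
    proof -
      have "q_Gamma q y = (q - 1) powr (1 - y) * q powr (y * (y - 1) / 2)
          * exp (log_pochhammer_inv p (p powr y) - log_pochhammer_inv p p)"
        unfolding q_Gamma_def powr using q q_Gamma_prodinf[OF p that] by simp
      then show ?thesis
        using q by (simp add: exp_add powr_def)
    qed
    show "(?h has_real_derivative - ln (q - 1) + (x - 1 / 2) * ln q + ln p * lambert p (p powr x)) (at x)"
      by (rule derivative_eq_intros DERIV_log_pochhammer_inv_powr p x refl | simp)+
  qed
  then show ?thesis
    using q_digamma_lambert[OF p x] ln1p by (simp add: p_def[symmetric] algebra_simps)
qed

section \<open>Convexity of the exponential of the Lambert series\<close>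

text \<open>
  The numerator and denominator of the first Pade approximant of \<open>exp\<close>. The derivative of the
  difference is \<open>1 - (1 - x) e\<^sup>x\<close>, which is positive since \<open>1 - x < e\<^bsup>-x\<^esup>\<close>.
\<close>

lemma two_minus_times_exp_less:
  fixes x :: real
  assumes "x > 0"
  shows "(2 - x) * exp x < 2 + x"
proof -
  let ?f = "\<lambda>x::real. 2 + x - (2 - x) * exp x"
  have "?f 0 < ?f x"
  proof (rule DERIV_pos_imp_increasing_open[OF assms])
    fix y :: real
    assume "0 < y"
    then have "(1 - y) * exp y < exp (- y) * exp y"
      by (intro mult_strict_right_mono) (auto simp: exp_minus_greater)
    then have "0 < 1 - (1 - y) * exp y"
      by (simp add: exp_minus)
    moreover have "(?f has_real_derivative 1 - (1 - y) * exp y) (at y)"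
      by (auto intro!: derivative_eq_intros simp: algebra_simps)
    ultimately show "\<exists>d. (?f has_real_derivative d) (at y) \<and> 0 < d"
      by blast
  qed (intro continuous_intros)
  then show ?thesis
    by simp
qed

text \<open>
  Because \<open>1 / (1 - e\<^bsup>-x\<^esup>) = (1 + coth (x / 2)) / 2\<close>, this is the bound \<open>coth y > 1 / y\<close> at \<open>y = x / 2\<close>.
\<close>

lemma inverse_one_minus_exp_bound:
  fixes x :: real
  assumes "x > 0"
  shows "1 / x + 1 / 2 < 1 / (1 - exp (- x))"
proof -
  have "exp (- x) * ((2 - x) * exp x) < exp (- x) * (2 + x)"
    using two_minus_times_exp_less[OF assms] by simp
  then have "2 - x < exp (- x) * (2 + x)"
    by (simp add: exp_minus mult.left_commute[of _ "2 - x"])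
  then have "(x + 2) * (1 - exp (- x)) < 2 * x"
    by (simp add: algebra_simps)
  moreover have "exp (- x) < 1"
    using assms by simp
  ultimately show ?thesis
    using assms by (simp add: field_simps)
qed

definition exp_lambert :: "real \<Rightarrow> real \<Rightarrow> real" where
  "exp_lambert p t = exp (ln p * lambert p t)"

context
  fixes p :: real
  assumes p: "0 < p" "p < 1"
begin

text \<open>
  Put \<open>L = - ln p\<close>, \<open>A = 1 - p\<^sup>a\<close> and \<open>B = 1 - p\<^sup>b\<close>. Then \<open>1 - p\<^bsup>a+b\<^esup> = A + B - A B\<close>, and after division by
  \<open>A B\<close> the claim reads \<open>1 / (L a) + 1 / (L b) < 1 / A + 1 / B - 1\<close>, the sum of two instances of the
  previous bound. This is the inequality between coefficients that makes \<open>exp_lambert p\<close> convex.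
\<close>

lemma lambert_coeff_convolution:
  assumes "a > 0" "b > 0"
  shows "real (a + b) * (1 / (1 - p ^ (a + b)))
    < - ln p * (real a * (1 / (1 - p ^ a)) * (real b * (1 / (1 - p ^ b))))"
proof -
  define L where "L = - ln p"
  have L: "L > 0"
    using p by (simp add: L_def ln_less_zero)
  have pow: "p ^ n = exp (- (L * real n))" for n
    using p by (simp add: L_def exp_of_nat_mult mult.commute)
  define A where "A = 1 - p ^ a"
  define B where "B = 1 - p ^ b"
  have AB: "A > 0" "B > 0"
    using power_less_one_pos[OF p] assms by (auto simp: A_def B_def)
  have C: "1 - p ^ (a + b) = A + B - A * B" "A + B - A * B > 0"
    using power_less_one_pos[OF p, of "a + b"] assms
    by (auto simp: A_def B_def power_add algebra_simps)
  have "1 / (L * a) + 1 / 2 + (1 / (L * b) + 1 / 2) < 1 / A + 1 / B"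
    using inverse_one_minus_exp_bound[of "L * a"] inverse_one_minus_exp_bound[of "L * b"] L assms
    by (simp add: A_def B_def pow)
  then have "1 / (L * a) + 1 / (L * b) < 1 / A + 1 / B - 1"
    by simp
  also have "1 / (L * a) + 1 / (L * b) = real (a + b) / (L * a * b)"
    using L assms by (simp add: field_simps)
  also have "1 / A + 1 / B - 1 = (A + B - A * B) / (A * B)"
    using AB by (simp add: field_simps)
  finally have "real (a + b) * (A * B) < (A + B - A * B) * (L * a * b)"
    using L assms AB by (simp add: divide_less_eq less_divide_eq field_simps)
  then have "real (a + b) / (A + B - A * B) < L * a * b / (A * B)"
    using AB C by (simp add: field_simps)
  then show ?thesis
    by (simp add: C(1) flip: A_def B_def L_def)
qed

text \<open>
  With \<open>G = exp (ln p \<cdot> P)\<close> one has \<open>G'' = G ln p (ln p \<cdot> P'\<^sup>2 + P'')\<close>, which is positive exactly if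
  \<open>P'' < - ln p \<cdot> P'\<^sup>2\<close>. The square is expanded as a Cauchy product: the coefficient of \<open>t\<^sup>n\<close> in it has
  \<open>n + 1\<close> terms, and \<open>P''\<close> has the coefficient \<open>(n + 1) (n + 2) / (1 - p\<^bsup>n+2\<^esup>)\<close>, which is split into
  \<open>n + 1\<close> equal parts to compare term by term.
\<close>

lemma exp_lambert_strictly_convex:
  obtains G' where "\<And>t. 0 < t \<Longrightarrow> t < 1 \<Longrightarrow> (exp_lambert p has_real_derivative G' t) (at t)"
    and "\<And>s t. 0 < s \<Longrightarrow> s < t \<Longrightarrow> t < 1 \<Longrightarrow> G' s < G' t"
proof -
  define b where "b = (\<lambda>n. 1 / (1 - p ^ n))"
  define P1 where "P1 = (\<lambda>t. \<Sum>n. diffs b n * t ^ n)"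
  define P2 where "P2 = (\<lambda>t. \<Sum>n. diffs (diffs b) n * t ^ n)"
  have sum0: "summable (\<lambda>n. b n * t ^ n)" if "norm t < 1" for t
    using summable_lambert[OF p that] by (simp add: b_def)
  have sum1: "summable (\<lambda>n. diffs b n * t ^ n)" if "norm t < 1" for t
    using termdiff_converges[OF that sum0] .
  have sum2: "summable (\<lambda>n. diffs (diffs b) n * t ^ n)" if "norm t < 1" for t
    using termdiff_converges[OF that sum1] .
  have d0: "(lambert p has_real_derivative P1 t) (at t)" if "norm t < 1" for t
    using termdiffs_strong'[OF sum0 that] by (simp add: lambert_def[abs_def] b_def P1_def)
  have d1: "(P1 has_real_derivative P2 t) (at t)" if "norm t < 1" for t
    using termdiffs_strong'[OF sum1 that] by (simp add: P1_def P2_def)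
  have b: "diffs b n > 0" for n
    using power_less_one_pos[OF p, of "Suc n"] by (simp add: diffs_def b_def)
  have riccati: "P2 t < - ln p * (P1 t)\<^sup>2" if t: "0 < t" "t < 1" for t
  proof -
    have "summable (\<lambda>n. norm (diffs b n * t ^ n))"
      using sum1[of t] t b by (simp add: abs_mult less_imp_le)
    from Cauchy_product_sums[OF this this]
    have "(\<lambda>n. \<Sum>i\<le>n. diffs b i * t ^ i * (diffs b (n - i) * t ^ (n - i))) sums (P1 t)\<^sup>2"
      by (simp add: P1_def power2_eq_square)
    also have "(\<lambda>n. \<Sum>i\<le>n. diffs b i * t ^ i * (diffs b (n - i) * t ^ (n - i)))
        = (\<lambda>n. (\<Sum>i\<le>n. diffs b i * diffs b (n - i)) * t ^ n)"
      unfolding sum_distrib_right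
      by (intro ext sum.cong refl) (simp add: mult_ac flip: power_add)
    finally have S: "(\<lambda>n. - ln p * ((\<Sum>i\<le>n. diffs b i * diffs b (n - i)) * t ^ n)
        - diffs (diffs b) n * t ^ n) sums (- ln p * (P1 t)\<^sup>2 - P2 t)"
      using summable_sums[OF sum2[of t]] t
      by (intro sums_diff sums_mult) (auto simp: P2_def)
    have pos: "0 < - ln p * ((\<Sum>i\<le>n. diffs b i * diffs b (n - i)) * t ^ n)
        - diffs (diffs b) n * t ^ n" for n
    proof -
      have "diffs (diffs b) n = (\<Sum>i\<le>n. real (n + 2) * b (n + 2))"
        by (simp add: diffs_def)
      also have "\<dots> < (\<Sum>i\<le>n. - ln p * (diffs b i * diffs b (n - i)))"
      proof (rule sum_strict_mono)
        fix i
        assume "i \<in> {..n}"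
        then have "Suc i + Suc (n - i) = n + 2"
          by simp
        then show "real (n + 2) * b (n + 2) < - ln p * (diffs b i * diffs b (n - i))"
          using lambert_coeff_convolution[of "Suc i" "Suc (n - i)"]
          by (simp only: diffs_def b_def)
      qed auto
      finally have "diffs (diffs b) n < - ln p * (\<Sum>i\<le>n. diffs b i * diffs b (n - i))"
        by (simp add: sum_distrib_left)
      then have "diffs (diffs b) n * t ^ n
          < - ln p * (\<Sum>i\<le>n. diffs b i * diffs b (n - i)) * t ^ n"
        using t by (intro mult_strict_right_mono) auto
      then show ?thesis
        by (simp add: mult.assoc)
    qed
    show ?thesis
      using suminf_pos[OF sums_summable[OF S] pos] sums_unique[OF S] by simp
  qed
  define G' where "G' = (\<lambda>t. exp_lambert p t * (ln p * P1 t))"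
  have dG: "(exp_lambert p has_real_derivative G' t) (at t)" if "norm t < 1" for t
    unfolding exp_lambert_def[abs_def] G'_def
    by (rule derivative_eq_intros d0 that refl)+ simp
  have dG': "(G' has_real_derivative exp_lambert p t * (ln p * (ln p * (P1 t)\<^sup>2 + P2 t))) (at t)"
    if "norm t < 1" for t
    unfolding G'_def
    by (rule derivative_eq_intros dG d1 that refl)+ (simp add: G'_def power2_eq_square algebra_simps)
  have "G' s < G' t" if "0 < s" "s < t" "t < 1" for s t
  proof (rule DERIV_pos_imp_increasing[OF \<open>s < t\<close>])
    fix x
    assume x: "s \<le> x" "x \<le> t"
    have "ln p * (P1 x)\<^sup>2 + P2 x < 0" "ln p < 0"
      using riccati[of x] x that p by (auto simp: ln_less_zero)
    then have "exp_lambert p x * (ln p * (ln p * (P1 x)\<^sup>2 + P2 x)) > 0"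
      by (intro mult_pos_pos mult_neg_neg) (auto simp: exp_lambert_def)
    then show "\<exists>y. (G' has_real_derivative y) (at x) \<and> 0 < y"
      using dG'[of x] x that by auto
  qed
  then show ?thesis
    using that[of G'] dG by auto
qed

end

text \<open>
  Up to the factor \<open>- (1 - p)\<close> the quotient is the slope of a chord of the convex function \<open>G\<close> over
  \<open>[p t, t]\<close>, and both endpoints of this interval grow with \<open>t\<close>. By the mean value theorem that slope is
  \<open>G' z\<close> for some \<open>z\<close> inside, and the derivative of the quotient becomes a positive multiple of
  \<open>p (G' (p t) - G' z) + (G' z - G' t)\<close>.
\<close>

lemma dilated_difference_quotient_decreasing:
  fixes G G' :: "real \<Rightarrow> real"
  assumes p: "0 < p" "p < 1"
    and G: "\<And>t. 0 < t \<Longrightarrow> t < 1 \<Longrightarrow> (G has_real_derivative G' t) (at t)"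
    and G': "\<And>s t. 0 < s \<Longrightarrow> s < t \<Longrightarrow> t < 1 \<Longrightarrow> G' s < G' t"
    and st: "0 < s" "s < t" "t < 1"
  shows "(G (p * t) - G t) / t < (G (p * s) - G s) / s"
proof (rule DERIV_neg_imp_decreasing[OF \<open>s < t\<close>])
  fix x
  assume x: "s \<le> x" "x \<le> t"
  then have x01: "0 < x" "x < 1"
    using st by auto
  have px: "0 < p * x" "p * x < x"
    using p x01 by auto
  obtain z where z: "p * x < z" "z < x" "G x - G (p * x) = (x - p * x) * G' z"
    using MVT2[OF px(2), of G G'] G x01 px by (metis dual_order.strict_trans1 order_le_less_trans)
  let ?d = "((p * G' (p * x) - G' x) * x - (G (p * x) - G x)) / (x * x)"
  have dpx: "((\<lambda>t. G (p * t)) has_real_derivative p * G' (p * x)) (at x)"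
    using DERIV_chain2[OF G[of "p * x"] DERIV_cmult_Id[of p]] px x01 by (simp add: mult.commute)
  have "((\<lambda>t. (G (p * t) - G t) / t) has_real_derivative ?d) (at x)"
    using x01 by (auto intro!: derivative_eq_intros dpx G)
  moreover have "?d < 0"
  proof -
    have "p * (G' (p * x) - G' z) + (G' z - G' x) < 0"
      using G'[of "p * x" z] G'[of z x] z px x01 p
      by (intro add_neg_neg mult_pos_neg) auto
    then have "x * (p * (G' (p * x) - G' z) + (G' z - G' x)) < 0"
      using x01 by (simp add: mult_pos_neg)
    also have "x * (p * (G' (p * x) - G' z) + (G' z - G' x))
        = (p * G' (p * x) - G' x) * x - (G (p * x) - G x)"
      using z(3) by (simp add: algebra_simps)
    finally show ?thesis
      using x01 by (simp add: divide_neg_pos)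
  qed
  ultimately show "\<exists>y. ((\<lambda>t. (G (p * t) - G t) / t) has_real_derivative y) (at x) \<and> y < 0"
    by blast
qed

section \<open>Monotonicity for bases below one\<close>

lemma powr_unit_interval:
  fixes p x :: real
  assumes "0 < p" "p < 1" "x > 0"
  shows "0 < p powr x" "p powr x < 1"
  using assms by (auto simp: powr01_less_one)

lemma divide_one_minus_less:
  fixes s t :: real
  assumes "s < t" "t < 1"
  shows "s / (1 - s) < t / (1 - t)"
  using assms by (simp add: field_simps)

text \<open>
  In the variable \<open>t = p\<^sup>x\<close> the exponents of \<^const>\<open>q_Phi\<close> and \<^const>\<open>q_Theta\<close> are \<open>u = - ln p \<cdot> t / (1 - t)\<close>
  and \<open>u - ln p\<close>.
\<close>

lemma q_Phi_exponent:
  fixes t :: real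
  assumes "t < 1"
  shows "ln p * t / (t - 1) = - ln p * (t / (1 - t))"
  using assms by (simp add: field_simps)

lemma q_Theta_exponent:
  fixes t :: real
  assumes "t < 1"
  shows "ln p / (t - 1) = - ln p * (t / (1 - t)) + - ln p"
  using assms by (simp add: field_simps)

text \<open>
  By \<open>lambert_diff\<close> the exponential in \<^const>\<open>q_Phi\<close> is \<open>G(pt) / G(t)\<close> for \<open>G = exp_lambert p\<close>, the
  denominator of which cancels against the \<open>p\<close>-digamma function, while \<open>- ln p \<cdot> x\<close> supplies the
  denominator \<open>t\<close>.
\<close>

lemma q_Phi_eq_difference_quotient:
  fixes p x :: real
  assumes p: "0 < p" "p < 1" and x: "x > 0"
  defines "t \<equiv> p powr x"
  shows "(exp_lambert p (p * t) - exp_lambert p t) / t > 0"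
    and "q_Phi p x = ln ((exp_lambert p (p * t) - exp_lambert p t) / t) - ln (1 - p)"
proof -
  let ?G = "exp_lambert p"
  have t: "0 < t" "t < 1"
    using powr_unit_interval[OF p x] by (auto simp: t_def)
  have "ln p < 0"
    using p by simp
  have "ln p * t / (t - 1) = ln p * lambert p (p * t) - ln p * lambert p t"
    unfolding q_Phi_exponent[OF t(2)] using lambert_diff[OF p, of t, symmetric] t
    by (simp add: right_diff_distrib del: times_divide_eq_right)
  then have u: "exp (ln p * t / (t - 1)) = ?G (p * t) / ?G t"
    by (simp add: exp_lambert_def exp_diff)
  have "ln p * t / (t - 1) > 0"
    using t \<open>ln p < 0\<close> by (simp add: divide_neg_neg mult_neg_pos)
  then have "?G (p * t) / ?G t > 1"
    unfolding u[symmetric] by simp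
  moreover have G: "?G t > 0"
    by (simp add: exp_lambert_def)
  ultimately have diff: "?G (p * t) - ?G t > 0"
    by (simp add: field_simps)
  then show "(?G (p * t) - ?G t) / t > 0"
    using t by simp
  have "exp (ln p * t / (t - 1)) - 1 = (?G (p * t) - ?G t) / ?G t"
    unfolding u using G by (simp add: field_simps)
  then have "ln (exp (ln p * t / (t - 1)) - 1) = ln (?G (p * t) - ?G t) - ln p * lambert p t"
    using G diff by (simp add: ln_div) (simp add: exp_lambert_def)
  moreover have "ln t = ln p * x"
    by (simp add: t_def ln_powr)
  ultimately show "q_Phi p x = ln ((?G (p * t) - ?G t) / t) - ln (1 - p)"
    using diff t by (simp add: q_Phi_def q_digamma_lambert[OF p x] ln_div flip: t_def)
qed

lemma strict_mono_on_q_Phi: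
  assumes p: "0 < p" "p < 1"
  shows "strict_mono_on {0<..} (q_Phi p)"
proof (rule strict_mono_onI)
  fix x y :: real
  assume xy: "x \<in> {0<..}" "y \<in> {0<..}" "x < y"
  obtain G' where G': "\<And>t. 0 < t \<Longrightarrow> t < 1 \<Longrightarrow> (exp_lambert p has_real_derivative G' t) (at t)"
    "\<And>s t. 0 < s \<Longrightarrow> s < t \<Longrightarrow> t < 1 \<Longrightarrow> G' s < G' t"
    using exp_lambert_strictly_convex[OF p] by blast
  have "p powr y < p powr x"
    using p xy by (simp add: powr_less_mono')
  then have "(exp_lambert p (p * p powr x) - exp_lambert p (p powr x)) / p powr x
      < (exp_lambert p (p * p powr y) - exp_lambert p (p powr y)) / p powr y"
    using dilated_difference_quotient_decreasing[OF p G'] powr_unit_interval[OF p] xy by auto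
  then show "q_Phi p x < q_Phi p y"
    using q_Phi_eq_difference_quotient[OF p] xy by auto
qed

lemma ln_exp_add_minus_one:
  fixes L u :: real
  assumes "L > 0" "u > 0"
  shows "ln (exp (u + L) - 1) = ln (exp u - 1) + ln (exp L + (exp L - 1) / (exp u - 1))"
proof -
  have u: "exp u - 1 > 0" and L: "exp L - 1 > 0"
    using assms by auto
  have "exp (u + L) - 1 = (exp u - 1) * (exp L + (exp L - 1) / (exp u - 1))"
    using u by (simp add: distrib_left exp_add) (simp add: algebra_simps)
  moreover have "exp L + (exp L - 1) / (exp u - 1) > 0"
    using u L by (intro add_pos_pos) auto
  ultimately show ?thesis
    using u by (simp add: ln_mult)
qed

text \<open>
  The difference between \<^const>\<open>q_Theta\<close> and \<^const>\<open>q_Phi\<close> is a decreasing function of \<open>u\<close> by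
  \<open>ln_exp_add_minus_one\<close>, and \<open>u\<close> decreases in \<open>x\<close>.
\<close>

lemma strict_mono_on_q_Theta:
  assumes p: "0 < p" "p < 1"
  shows "strict_mono_on {0<..} (q_Theta p)"
proof (rule strict_mono_onI)
  fix x y :: real
  assume xy: "x \<in> {0<..}" "y \<in> {0<..}" "x < y"
  define L where "L = - ln p"
  have L: "L > 0"
    using p by (simp add: L_def)
  define u where "u = (\<lambda>x. L * (p powr x / (1 - p powr x)))"
  define r where "r = (\<lambda>u. exp L + (exp L - 1) / (exp u - 1))"
  have u: "u z > 0" if "z > 0" for z
    using L powr_unit_interval[OF p that] by (simp add: u_def)
  have Theta: "q_Theta p z = q_Phi p z + ln (r (u z))" if "z > 0" for z
  proof -
    have t: "p powr z < 1"
      using powr_unit_interval[OF p that] by simp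
    show ?thesis
      unfolding q_Theta_def q_Phi_def q_Phi_exponent[OF t] q_Theta_exponent[OF t]
      using ln_exp_add_minus_one[OF L u[OF that]] by (simp add: u_def r_def L_def)
  qed
  have "u y < u x"
    unfolding u_def using L p xy powr_unit_interval[OF p]
    by (intro mult_strict_left_mono divide_one_minus_less) (auto simp: powr_less_mono')
  then have "r (u x) < r (u y)"
    unfolding r_def using L u[of y] u[of x] xy
    by (intro add_strict_left_mono divide_strict_left_mono mult_pos_pos) auto
  moreover have "r (u x) > 0"
    unfolding r_def using L u[of x] xy by (intro add_pos_nonneg) auto
  ultimately have "ln (r (u x)) < ln (r (u y))"
    by simp
  moreover have "q_Phi p x < q_Phi p y"
    using strict_mono_onD[OF strict_mono_on_q_Phi[OF p]] xy by blast
  ultimately show "q_Theta p x < q_Theta p y"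
    using Theta xy by auto
qed

section \<open>Limits for bases below one\<close>

lemma isCont_lambert:
  assumes "0 < p" "p < 1" "\<bar>t\<bar> < 1"
  shows "isCont (lambert p) t"
  using DERIV_isCont[OF termdiffs_strong'[of 1 "\<lambda>n. 1 / (1 - p ^ n)" t, OF summable_lambert]] assms
  by (simp add: lambert_def[abs_def])

text \<open>
  As \<open>x\<close> grows, \<open>t = p\<^sup>x\<close> tends to \<open>0\<close>. The term \<open>- ln p \<cdot> x\<close> is written as the denominator \<open>t\<close> inside the
  logarithm, where the limit is the derivative of \<open>exp (- ln p \<cdot> t / (1 - t))\<close> at \<open>t = 0\<close>.
\<close>

lemma q_Phi_tendsto_at_top:
  assumes p: "0 < p" "p < 1"
  shows "(q_Phi p \<longlongrightarrow> ln (ln p / (p - 1))) at_top"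
proof -
  let ?e = "\<lambda>t. exp (- ln p * (t / (1 - t)))"
  let ?F = "\<lambda>t. - ln (1 - p) + ln p * lambert p t + ln ((?e t - 1) / t)"
  have "ln p < 0"
    using p by simp
  have "(?e has_real_derivative - ln p) (at 0)"
    by (auto intro!: derivative_eq_intros)
  then have "((\<lambda>t. (?e t - 1) / t) \<longlongrightarrow> - ln p) (at 0)"
    by (simp add: has_field_derivative_iff)
  moreover have "(lambert p \<longlongrightarrow> 0) (at 0)"
    using isCont_lambert[OF p, of 0] powser_zero[of "\<lambda>n. 1 / (1 - p ^ n)"]
    by (simp add: isCont_def lambert_def)
  ultimately have "(?F \<longlongrightarrow> - ln (1 - p) + ln p * 0 + ln (- ln p)) (at 0)"
    using \<open>ln p < 0\<close> by (intro tendsto_intros) auto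
  moreover have "filterlim (\<lambda>x. p powr x) (at 0) at_top"
  proof -
    have "filterlim (\<lambda>x. ln p * x) at_bot at_top"
      using \<open>ln p < 0\<close> by (rule filterlim_tendsto_neg_mult_at_bot[OF tendsto_const _ filterlim_ident])
    from filterlim_compose[OF exp_at_bot this] show ?thesis
      using p by (simp add: powr_def filterlim_at mult.commute)
  qed
  ultimately have "((\<lambda>x. ?F (p powr x)) \<longlongrightarrow> - ln (1 - p) + ln p * 0 + ln (- ln p)) at_top"
    by (rule filterlim_compose)
  moreover have "- ln (1 - p) + ln p * 0 + ln (- ln p) = ln (ln p / (p - 1))"
  proof -
    have "ln p / (p - 1) = - ln p / (1 - p)"
      using p by (simp add: field_simps)
    then show ?thesis
      using p \<open>ln p < 0\<close> ln_div[of "- ln p" "1 - p"] by auto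
  qed
  moreover have "eventually (\<lambda>x. ?F (p powr x) = q_Phi p x) at_top"
    using eventually_gt_at_top[of 0]
  proof eventually_elim
    case (elim x)
    note t = powr_unit_interval[OF p elim]
    have "?e (p powr x) - 1 > 0"
      using t \<open>ln p < 0\<close> by (simp add: mult_less_0_iff divide_less_0_iff)
    then have "ln ((?e (p powr x) - 1) / p powr x) = ln (?e (p powr x) - 1) - ln p * x"
      using t by (simp add: ln_div ln_powr)
    then show ?case
      unfolding q_Phi_def q_Phi_exponent[OF t(2)] q_digamma_lambert[OF p elim] by simp
  qed
  ultimately show ?thesis
    using tendsto_cong by force
qed

text \<open>
  The \<open>p\<close>-digamma function and the logarithm are both unbounded at \<open>0\<close>. Their poles cancel once
  \<open>lambert_diff\<close> moves the argument of the Lambert series from \<open>t\<close> to \<open>p t\<close>, inside its disc of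
  convergence also for \<open>t = 1\<close>: the correction \<open>- u\<close> turns \<open>ln (e\<^sup>u - 1)\<close> into \<open>ln (1 - e\<^bsup>-u\<^esup>)\<close>, which
  vanishes as \<open>u\<close> tends to infinity.
\<close>

lemma q_Phi_tendsto_at_right_0:
  assumes p: "0 < p" "p < 1"
  shows "(q_Phi p \<longlongrightarrow> q_digamma p 1) (at_right 0)"
proof -
  let ?F = "\<lambda>x. - ln (1 - p) + ln p * lambert p (p * p powr x) - ln p * x
      + ln (1 - exp (ln p * (p powr x * inverse (1 - p powr x))))"
  have "ln p < 0"
    using p by simp
  have "(\<lambda>x. p powr x) \<midarrow>0\<rightarrow> p powr 0"
    using p by (intro tendsto_intros) auto
  then have lim1: "((\<lambda>x. p powr x) \<longlongrightarrow> 1) (at_right 0)"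
    using p filterlim_mono[OF _ order_refl at_le[of "{0<..}" UNIV]] by auto
  have pos: "eventually (\<lambda>x. x > (0::real)) (at_right 0)"
    by (rule eventually_at_right_less)
  have "((\<lambda>x. 1 - p powr x) \<longlongrightarrow> 1 - 1) (at_right 0)"
    by (intro tendsto_intros lim1)
  moreover have "eventually (\<lambda>x. 0 < 1 - p powr x) (at_right 0)"
    using pos by eventually_elim (use powr_unit_interval[OF p] in auto)
  ultimately have "filterlim (\<lambda>x. inverse (1 - p powr x)) at_top (at_right 0)"
    by (intro filterlim_inverse_at_top) auto
  then have "filterlim (\<lambda>x. p powr x * inverse (1 - p powr x)) at_top (at_right 0)"
    by (intro filterlim_tendsto_pos_mult_at_top[OF lim1]) auto
  then have "filterlim (\<lambda>x. ln p * (p powr x * inverse (1 - p powr x))) at_bot (at_right 0)"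
    by (rule filterlim_tendsto_neg_mult_at_bot[OF tendsto_const \<open>ln p < 0\<close>])
  then have "((\<lambda>x. exp (ln p * (p powr x * inverse (1 - p powr x)))) \<longlongrightarrow> 0) (at_right 0)"
    by (rule filterlim_compose[OF exp_at_bot])
  moreover have "((\<lambda>x. lambert p (p * p powr x)) \<longlongrightarrow> lambert p (p * 1)) (at_right 0)"
    using p by (intro isCont_tendsto_compose[OF isCont_lambert] tendsto_intros lim1) auto
  ultimately have "(?F \<longlongrightarrow> - ln (1 - p) + ln p * lambert p (p * 1) - ln p * 0 + ln (1 - 0)) (at_right 0)"
    by (intro tendsto_intros) auto
  then have "(?F \<longlongrightarrow> q_digamma p 1) (at_right 0)"
    using q_digamma_lambert[OF p, of 1] p by simp
  moreover have "eventually (\<lambda>x. ?F x = q_Phi p x) (at_right 0)"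
    using pos
  proof eventually_elim
    case (elim x)
    define t where "t = p powr x"
    have t: "0 < t" "t < 1"
      using powr_unit_interval[OF p elim] by (auto simp: t_def)
    define u where "u = - ln p * (t / (1 - t))"
    have u: "u > 0"
      unfolding u_def using t \<open>ln p < 0\<close> by (intro mult_pos_pos) auto
    have "exp u - 1 = exp u * (1 - exp (- u))"
      by (simp add: right_diff_distrib flip: exp_add)
    then have "ln (exp u - 1) = u + ln (1 - exp (- u))"
      using u by (simp add: ln_mult)
    moreover have "ln p * lambert p t = ln p * lambert p (p * t) - u"
      unfolding u_def using lambert_diff[OF p, of t, symmetric] t
      by (simp add: right_diff_distrib del: times_divide_eq_right)
    moreover have "ln p * (t * inverse (1 - t)) = - u"
      by (simp add: u_def divide_inverse)
    ultimately show ?case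
      unfolding q_Phi_def t_def[symmetric] q_Phi_exponent[OF t(2)] q_digamma_lambert[OF p elim] u_def[symmetric]
      by simp
  qed
  ultimately show ?thesis
    using tendsto_cong by force
qed

section \<open>Bases above one\<close>

lemma inverse_base_powr:
  fixes q x :: real
  assumes "q > 1"
  shows "q powr x = 1 / ((1 / q) powr x)"
  using assms by (simp add: powr_divide)

lemma q_varphi_inverse_base:
  assumes q: "q > 1" and x: "x > 0"
  shows "q_varphi q x = q_Phi (1 / q) x - 3 / 2 * ln q"
proof -
  define t where "t = (1 / q) powr x"
  have t: "0 < t" "t < 1"
    using powr_unit_interval[of "1 / q" x] q x by (auto simp: t_def)
  have "ln q / (q powr x - 1) = ln (1 / q) * t / (t - 1)"
    unfolding inverse_base_powr[OF q] t_def[symmetric] using q t by (simp add: ln_div field_simps)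
  then show ?thesis
    using q by (simp add: q_varphi_def q_Phi_def q_digamma_inverse_base[OF q x] ln_div algebra_simps flip: t_def)
qed

lemma q_phi_inverse_base:
  assumes q: "q > 1" and x: "x > 0"
  shows "q_phi q x = q_Theta (1 / q) x - 3 / 2 * ln q"
proof -
  define t where "t = (1 / q) powr x"
  have t: "0 < t" "t < 1"
    using powr_unit_interval[of "1 / q" x] q x by (auto simp: t_def)
  have "ln q * q powr x / (q powr x - 1) = ln (1 / q) / (t - 1)"
    unfolding inverse_base_powr[OF q] t_def[symmetric] using q t by (simp add: ln_div field_simps)
  then show ?thesis
    using q by (simp add: q_phi_def q_Theta_def q_digamma_inverse_base[OF q x] ln_div algebra_simps flip: t_def)
qed

lemma q_varphi_mono_limits:
  assumes q: "q > 1"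
  shows "strict_mono_on {0<..} (q_varphi q)"
    and "(q_varphi q \<longlongrightarrow> q_digamma q 1 - ln q) (at_right 0)"
    and "(q_varphi q \<longlongrightarrow> ln (ln q / (q - 1)) - ln q / 2) at_top"
proof -
  have p: "0 < 1 / q" "1 / q < 1"
    using q by auto
  show "strict_mono_on {0<..} (q_varphi q)"
    using strict_mono_on_q_Phi[OF p] q_varphi_inverse_base[OF q]
    by (auto simp: strict_mono_on_def)
  have "((\<lambda>x. q_Phi (1 / q) x - 3 / 2 * ln q) \<longlongrightarrow> q_digamma (1 / q) 1 - 3 / 2 * ln q) (at_right 0)"
    by (intro tendsto_intros q_Phi_tendsto_at_right_0 p)
  moreover have "q_digamma (1 / q) 1 - 3 / 2 * ln q = q_digamma q 1 - ln q"
    using q_digamma_inverse_base[OF q, of 1] by simp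
  moreover have "eventually (\<lambda>x. q_Phi (1 / q) x - 3 / 2 * ln q = q_varphi q x) (at_right 0)"
    using eventually_at_right_less[of 0] by eventually_elim (simp add: q_varphi_inverse_base[OF q])
  ultimately show "(q_varphi q \<longlongrightarrow> q_digamma q 1 - ln q) (at_right 0)"
    using tendsto_cong by force
  have "((\<lambda>x. q_Phi (1 / q) x - 3 / 2 * ln q) \<longlongrightarrow> ln (ln (1 / q) / (1 / q - 1)) - 3 / 2 * ln q) at_top"
    by (intro tendsto_intros q_Phi_tendsto_at_top p)
  moreover have "ln (ln (1 / q) / (1 / q - 1)) - 3 / 2 * ln q = ln (ln q / (q - 1)) - ln q / 2"
  proof -
    have "ln (1 / q) / (1 / q - 1) = q * (ln q / (q - 1))"
      using q by (simp add: ln_div field_simps)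
    moreover have "ln q / (q - 1) > 0"
      using q by simp
    ultimately have "ln (ln (1 / q) / (1 / q - 1)) = ln q + ln (ln q / (q - 1))"
      using q by (simp only: ln_mult) auto
    then show ?thesis
      by simp
  qed
  moreover have "eventually (\<lambda>x. q_Phi (1 / q) x - 3 / 2 * ln q = q_varphi q x) at_top"
    using eventually_gt_at_top[of 0] by eventually_elim (simp add: q_varphi_inverse_base[OF q])
  ultimately show "(q_varphi q \<longlongrightarrow> ln (ln q / (q - 1)) - ln q / 2) at_top"
    using tendsto_cong by force
qed

lemma strict_mono_on_q_phi:
  assumes q: "q > 1"
  shows "strict_mono_on {0<..} (q_phi q)"
  using strict_mono_on_q_Theta[of "1 / q"] q q_phi_inverse_base[OF q]
  by (auto simp: strict_mono_on_def)

section \<open>Sharp bounds\<close>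

text \<open>
  Sharpness is the fact that a bound for all \<open>x\<close> passes to the limit.
\<close>

lemma strict_mono_on_sharp_bounds:
  fixes f :: "real \<Rightarrow> real"
  assumes mono: "strict_mono_on {0<..} f"
    and l: "(f \<longlongrightarrow> l) (at_right 0)" and m: "(f \<longlongrightarrow> m) at_top"
  shows "\<forall>x>0. l < f x \<and> f x < m"
    and "\<not> (\<exists>c>l. \<forall>x>0. c < f x)"
    and "\<not> (\<exists>c<m. \<forall>x>0. f x < c)"
proof -
  have less: "f x < f y" if "0 < x" "x < y" for x y
    using strict_mono_onD[OF mono] that by auto
  show "\<forall>x>0. l < f x \<and> f x < m"
  proof (intro allI impI conjI)
    fix x :: real
    assume x: "x > 0"
    have "eventually (\<lambda>y. f y \<le> f (x / 2)) (at_right 0)"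
      by (rule eventually_at_rightI[of 0 "x / 2"]) (use x less in \<open>auto intro: less_imp_le\<close>)
    then have "l \<le> f (x / 2)"
      by (rule tendsto_upperbound[OF l]) simp
    then show "l < f x"
      using less[of "x / 2" x] x by simp
    have "eventually (\<lambda>y. f (x + 1) \<le> f y) at_top"
      using eventually_gt_at_top[of "x + 1"] by eventually_elim (use x less in \<open>auto intro: less_imp_le\<close>)
    then have "f (x + 1) \<le> m"
      by (rule tendsto_lowerbound[OF m]) simp
    then show "f x < m"
      using less[of x "x + 1"] x by simp
  qed
  have "c \<le> l" if "\<forall>x>0. c < f x" for c
    by (rule tendsto_lowerbound[OF l eventually_at_rightI[of 0 1]]) (use that in \<open>auto intro: less_imp_le\<close>)
  then show "\<not> (\<exists>c>l. \<forall>x>0. c < f x)"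
    by force
  have "m \<le> c" if "\<forall>x>0. f x < c" for c
    by (rule tendsto_upperbound[OF m eventually_mono[OF eventually_gt_at_top[of 0]]])
      (use that in \<open>auto intro: less_imp_le\<close>)
  then show "\<not> (\<exists>c<m. \<forall>x>0. f x < c)"
    by force
qed

lemma q_Phi_less_iff:
  "c < q_Phi q x \<longleftrightarrow> c + ln q * x - ln (exp (ln q * q powr x / (q powr x - 1)) - 1) < q_digamma q x"
  "q_Phi q x < c \<longleftrightarrow> q_digamma q x < c + ln q * x - ln (exp (ln q * q powr x / (q powr x - 1)) - 1)"
  by (auto simp: q_Phi_def)

lemma q_varphi_less_iff:
  "c < q_varphi q x \<longleftrightarrow> c - ln (exp (ln q / (q powr x - 1)) - 1) < q_digamma q x"
  "q_varphi q x < c \<longleftrightarrow> q_digamma q x < c - ln (exp (ln q / (q powr x - 1)) - 1)"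
  by (auto simp: q_varphi_def)

theorem corollary1p1:
  shows
    "(\<forall>q>1. strict_mono_on {0<..} (q_phi q)) \<and>
     (\<forall>q>1. strict_mono_on {0<..} (q_varphi q)) \<and>
     (\<forall>q. 0 < q \<and> q < 1 \<longrightarrow> strict_mono_on {0<..} (q_Phi q)) \<and>
     (\<forall>q. 0 < q \<and> q < 1 \<longrightarrow> strict_mono_on {0<..} (q_Theta q)) \<and>
     (\<forall>q::real. 0 < q \<and> q < 1 \<longrightarrow>
        (\<forall>x>0.
           q_digamma q 1 + ln q * x - ln (exp (ln q * q powr x / (q powr x - 1)) - 1)
             < q_digamma q x \<and>
           q_digamma q x
             < ln (ln q / (q - 1)) + ln q * x
                 - ln (exp (ln q * q powr x / (q powr x - 1)) - 1)) \<and>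
        \<not> (\<exists>c > q_digamma q 1. \<forall>x>0.
              c + ln q * x - ln (exp (ln q * q powr x / (q powr x - 1)) - 1)
                < q_digamma q x) \<and>
        \<not> (\<exists>c < ln (ln q / (q - 1)). \<forall>x>0.
              q_digamma q x
                < c + ln q * x - ln (exp (ln q * q powr x / (q powr x - 1)) - 1))) \<and>
     (\<forall>q::real. q > 1 \<longrightarrow>
        (\<forall>x>0.
           q_digamma q 1 - ln q - ln (exp (ln q / (q powr x - 1)) - 1) < q_digamma q x \<and>
           q_digamma q x
             < ln (ln q / (q - 1)) - ln q / 2 - ln (exp (ln q / (q powr x - 1)) - 1)) \<and>
        \<not> (\<exists>c > q_digamma q 1 - ln q. \<forall>x>0.
              c - ln (exp (ln q / (q powr x - 1)) - 1) < q_digamma q x) \<and>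
        \<not> (\<exists>c < ln (ln q / (q - 1)) - ln q / 2. \<forall>x>0.
              q_digamma q x < c - ln (exp (ln q / (q powr x - 1)) - 1)))"
proof (intro conjI allI impI; (elim conjE)?)
  show "strict_mono_on {0<..} (q_phi q)" if "q > 1" for q
    by (rule strict_mono_on_q_phi[OF that])
  show "strict_mono_on {0<..} (q_varphi q)" if "q > 1" for q
    by (rule q_varphi_mono_limits(1)[OF that])
  show "strict_mono_on {0<..} (q_Phi q)" if "0 < q" "q < 1" for q
    by (rule strict_mono_on_q_Phi[OF that])
  show "strict_mono_on {0<..} (q_Theta q)" if "0 < q" "q < 1" for q
    by (rule strict_mono_on_q_Theta[OF that])
  \<comment> \<open>The bounds are statements about \<^term>\<open>q_Phi q\<close> and \<^term>\<open>q_varphi q\<close> lying between their limits.\<close>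
qed (use strict_mono_on_sharp_bounds[OF strict_mono_on_q_Phi q_Phi_tendsto_at_right_0 q_Phi_tendsto_at_top]
    strict_mono_on_sharp_bounds[OF q_varphi_mono_limits]
  in \<open>auto simp flip: q_Phi_less_iff q_varphi_less_iff\<close>)
end
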